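(* Let $n,m,r$ be positive integers with $r<n$ and $r<m$, let $V\in\mathbb{R}^{n\times m}$ be an entrywise nonnegative matrix with each column normalized, and let $f(W,H)=\|V-WH\|_F^2$ for $W\in\mathbb{R}^{n\times r}$, $H\in\mathbb{R}^{r\times m}$. Let $\{(W^k,H^k)\}_{k\ge 0}$ be the sequence generated by the INOM algorithm (defined in the context, including the normalization of the columns of $W$ at every iteration) from an entrywise nonnegative starting point $(W^0,H^0)$ with each column of $W^0$ normalized. Then the step sizes determined by $\mu^k$ and $\nu^k$ ensure the monotonic decrease of the respective cost functions, $H\mapsto f(W^k,H)$ in the $H$ update and $W\mapsto f(W,H^{k+1})$ in the $W$ update, and the algorithm is monotonic: for every $k\ge 0$, $$f(W^{k+1},H^{k+1})\le f(W^k,H^{k+1})\le f(W^k,H^k).$$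
   Context: The operation $\max(0,\cdot)$ of a matrix is taken entrywise. $\|\cdot\|_F$ is the Frobenius norm. The maximum row sum of a square matrix $A=(a_{ij})$ is $\max_i\sum_j a_{ij}$. To normalize a column means to divide it by its norm, for a fixed choice of vector norm. INOM algorithm: given $(W^k,H^k)$, perform in order: (1) let $\mu^k$ be the maximum row sum of $2(W^k)^TW^k$; (2) set $H^{k+1}=H^k+\tfrac{1}{\mu^k}\bigl(2(W^k)^TV-2(W^k)^TW^kH^k\bigr)$; (3) replace $H^{k+1}$ by $\max(0,H^{k+1})$; (4) let $\nu^k$ be the maximum row sum of $2H^{k+1}(H^{k+1})^T$; (5) set $W^{k+1}=W^k+\tfrac{1}{\nu^k}\bigl(2V(H^{k+1})^T-2W^kH^{k+1}(H^{k+1})^T\bigr)$; (6) replace $W^{k+1}$ by $\max(0,W^{k+1})$; (7) normalize each column of $W^{k+1}$ ($H^{k+1}$ is not rescaled). "Monotonic decrease" is meant in the non-strict sense (the cost does not increase).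
   Formalization: The vector norm used to normalize the columns of V and W, left open in the statement, is taken to be the Euclidean norm; for other norms such as the l1 norm the inequality f(W^{k+1},H^{k+1}) ≤ f(W^k,H^{k+1}) can fail. *)

theory Defs
  imports "HOL-Analysis.Analysis"
begin

(* An n x m real matrix has type real^'m^'n: A $ i $ j is row i :: 'n, column j :: 'm. *)

definition nonneg_mat :: "real^'m^'n \<Rightarrow> bool" where
  "nonneg_mat A \<longleftrightarrow> (\<forall>i j. 0 \<le> A $ i $ j)"

definition pos_part :: "real^'m^'n \<Rightarrow> real^'m^'n" where
  "pos_part A = (\<chi> i j. max 0 (A $ i $ j))"

definition max_row_sum :: "real^'n^'n \<Rightarrow> real" where
  "max_row_sum A = Max (range (\<lambda>i. \<Sum>j\<in>UNIV. A $ i $ j))"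

(* The vector norm used for normalization is fixed to be the Euclidean one, which is
   norm on real^'n. *)

definition columns_normalized :: "real^'m^'n \<Rightarrow> bool" where
  "columns_normalized A \<longleftrightarrow> (\<forall>j. norm (column j A) = 1)"

(* A zero column is mapped to a zero column, since x / 0 = 0. *)
definition normalize_columns :: "real^'m^'n \<Rightarrow> real^'m^'n" where
  "normalize_columns A = (\<chi> i j. A $ i $ j / norm (column j A))"

lemma norm_matrix_eq_Frobenius:
  fixes A :: "real^'m^'n"
  shows "norm A = sqrt (\<Sum>i\<in>UNIV. \<Sum>j\<in>UNIV. (A $ i $ j)\<^sup>2)"
  by (simp add: norm_vec_def L2_set_def sum_nonneg)

definition nmf_cost :: "real^'m^'n \<Rightarrow> real^'r^'n \<Rightarrow> real^'m^'r \<Rightarrow> real" where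
  "nmf_cost V W H = (norm (V - W ** H))\<^sup>2"

definition inom_mu :: "real^'r^'n \<Rightarrow> real" where
  "inom_mu W = max_row_sum (2 *\<^sub>R (transpose W ** W))"

definition inom_nu :: "real^'m^'r \<Rightarrow> real" where
  "inom_nu H = max_row_sum (2 *\<^sub>R (H ** transpose H))"

(* For nonnegative arguments these step sizes vanish only at the zero matrix; then 1 / 0 = 0
   makes the corresponding gradient step the identity. *)

definition inom_H_update ::
    "real^'m^'n \<Rightarrow> real^'r^'n \<Rightarrow> real^'m^'r \<Rightarrow> real^'m^'r" where
  "inom_H_update V W H =
     pos_part (H + (1 / inom_mu W) *\<^sub>R
       (2 *\<^sub>R (transpose W ** V) - 2 *\<^sub>R (transpose W ** W ** H)))"

(* The update of W before its columns are normalized. *)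
definition inom_W_update ::
    "real^'m^'n \<Rightarrow> real^'r^'n \<Rightarrow> real^'m^'r \<Rightarrow> real^'r^'n" where
  "inom_W_update V W H =
     pos_part (W + (1 / inom_nu H) *\<^sub>R
       (2 *\<^sub>R (V ** transpose H) - 2 *\<^sub>R (W ** H ** transpose H)))"

definition inom_sequence ::
    "real^'m^'n \<Rightarrow> (nat \<Rightarrow> real^'r^'n) \<Rightarrow> (nat \<Rightarrow> real^'m^'r) \<Rightarrow> bool" where
  "inom_sequence V W H \<longleftrightarrow>
     (\<forall>k. H (Suc k) = inom_H_update V (W k) (H k) \<and>
          W (Suc k) = normalize_columns (inom_W_update V (W k) (H (Suc k))))"

end

theory Submission
  imports Defs
begin

text \<open>
  A nonnegative symmetric matrix whose row sums are at most \<open>\<mu>\<close> is dominated by \<open>\<mu> I\<close>. Hence the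
  cost is majorized by a quadratic with Hessian \<open>\<mu> I\<close> (respectively \<open>\<nu> I\<close>) whose
  minimizer over a constraint set is the point of the set nearest to the gradient step \<open>Z\<close>.
  For the nonnegative matrices this nearest point is the positive part of \<open>Z\<close>, and for the nonnegative
  matrices with unit columns it is the normalized positive part, provided that the latter has no
  zero column. So the normalization does not spoil the descent as long as the columns of \<open>W\<^sup>k\<close> are
  unit vectors. A column \<open>j\<close> of the positive part never vanishes: otherwise,
  with \<open>s = \<nu> / 2\<close> and \<open>G = H H\<^sup>T\<close>,
  \<open>s w\<^sub>j + V h\<^sub>j \<le> (\<Sum>i. G\<^sub>i\<^sub>j w\<^sub>i)\<close> entrywise, where the right-hand side has norm at most \<open>s\<close> and
  the left-hand side has norm greater than \<open>s\<close> unless \<open>h\<^sub>j = 0\<close>.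
\<close>

section \<open>Matrix algebra and the Frobenius inner product\<close>

lemma inner_matrix_eq_sum:
  fixes A B :: "real^'m^'n"
  shows "A \<bullet> B = (\<Sum>i\<in>UNIV. \<Sum>j\<in>UNIV. A $ i $ j * B $ i $ j)"
  by (simp add: inner_vec_def)

lemma inner_matrix_mult_left:
  fixes W :: "real^'r^'n" and D :: "real^'m^'r" and R :: "real^'m^'n"
  shows "(W ** D) \<bullet> R = D \<bullet> (transpose W ** R)"
proof -
  have "(W ** D) \<bullet> R = (\<Sum>i\<in>UNIV. \<Sum>j\<in>UNIV. \<Sum>k\<in>UNIV. W $ i $ k * D $ k $ j * R $ i $ j)"
    by (simp add: inner_matrix_eq_sum matrix_matrix_mult_def sum_distrib_right)
  also have "\<dots> = (\<Sum>i\<in>UNIV. \<Sum>k\<in>UNIV. \<Sum>j\<in>UNIV. W $ i $ k * D $ k $ j * R $ i $ j)"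
    by (intro sum.cong refl sum.swap)
  also have "\<dots> = (\<Sum>k\<in>UNIV. \<Sum>i\<in>UNIV. \<Sum>j\<in>UNIV. W $ i $ k * D $ k $ j * R $ i $ j)"
    by (rule sum.swap)
  also have "\<dots> = (\<Sum>k\<in>UNIV. \<Sum>j\<in>UNIV. \<Sum>i\<in>UNIV. W $ i $ k * D $ k $ j * R $ i $ j)"
    by (intro sum.cong refl sum.swap)
  also have "\<dots> = D \<bullet> (transpose W ** R)"
    by (simp add: inner_matrix_eq_sum matrix_matrix_mult_def transpose_def sum_distrib_left mult_ac)
  finally show ?thesis .
qed

lemma norm_transpose:
  fixes A :: "real^'m^'n"
  shows "norm (transpose A) = norm A"
proof -
  have "(\<Sum>i\<in>UNIV. \<Sum>j\<in>UNIV. (A $ j $ i)\<^sup>2) = (\<Sum>i\<in>UNIV. \<Sum>j\<in>UNIV. (A $ i $ j)\<^sup>2)"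
    by (rule sum.swap)
  then show ?thesis
    by (simp add: norm_matrix_eq_Frobenius transpose_def)
qed

lemma norm_matrix_power2_columns:
  fixes A :: "real^'m^'n"
  shows "(norm A)\<^sup>2 = (\<Sum>j\<in>UNIV. (norm (column j A))\<^sup>2)"
proof -
  have "(norm A)\<^sup>2 = (\<Sum>i\<in>UNIV. \<Sum>j\<in>UNIV. (A $ i $ j)\<^sup>2)"
    by (simp add: norm_matrix_eq_Frobenius sum_nonneg)
  also have "\<dots> = (\<Sum>j\<in>UNIV. \<Sum>i\<in>UNIV. (A $ i $ j)\<^sup>2)"
    by (rule sum.swap)
  finally show ?thesis
    by (simp add: norm_vec_def L2_set_def sum_nonneg column_def)
qed

lemma matrix_mult_diff_right:
  fixes A :: "real^'r^'n" and B C :: "real^'m^'r"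
  shows "A ** (B - C) = A ** B - A ** C"
  by (simp add: matrix_matrix_mult_def vec_eq_iff right_diff_distrib sum_subtractf)

lemma transpose_diff: "transpose (A - B) = transpose A - transpose (B :: real^'m^'n)"
  by (simp add: transpose_def vec_eq_iff)

lemma transpose_add: "transpose (A + B) = transpose A + transpose (B :: real^'m^'n)"
  by (simp add: transpose_def vec_eq_iff)

lemma nonneg_mat_transpose [simp]: "nonneg_mat (transpose A) \<longleftrightarrow> nonneg_mat A"
  by (auto simp: nonneg_mat_def transpose_def)

lemma nonneg_mat_mult: "nonneg_mat A \<Longrightarrow> nonneg_mat B \<Longrightarrow> nonneg_mat (A ** B)"
  by (simp add: nonneg_mat_def matrix_matrix_mult_def sum_nonneg)

lemma nonneg_mat_pos_part [simp]: "nonneg_mat (pos_part A)"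
  by (simp add: nonneg_mat_def pos_part_def)

lemma nonneg_mat_normalize_columns: "nonneg_mat A \<Longrightarrow> nonneg_mat (normalize_columns A)"
  by (simp add: nonneg_mat_def normalize_columns_def)

lemma column_normalize_columns:
  "column j (normalize_columns A) = (1 / norm (column j A)) *\<^sub>R column j A"
  by (simp add: vec_eq_iff column_def normalize_columns_def)

section \<open>Row sums as bounds for quadratic forms\<close>

lemma row_sum_le_max_row_sum: "(\<Sum>j\<in>UNIV. A $ i $ j) \<le> max_row_sum A"
  unfolding max_row_sum_def by (rule Max_ge) auto

lemma max_row_sum_nonneg:
  assumes "nonneg_mat A"
  shows "0 \<le> max_row_sum A"
proof -
  have "0 \<le> (\<Sum>j\<in>UNIV. A $ undefined $ j)"
    using assms by (simp add: nonneg_mat_def sum_nonneg)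
  also have "\<dots> \<le> max_row_sum A"
    by (rule row_sum_le_max_row_sum)
  finally show ?thesis .
qed

text \<open>Each product of entries of \<open>D\<close> is at most the mean of their squares, and
  nonnegative weights preserve this. By symmetry of \<open>A\<close> the two sums of squares
  coincide, and each is bounded by row sums.\<close>

lemma inner_sym_nonneg_le_max_row_sum:
  fixes A :: "real^'r^'r" and D :: "real^'m^'r"
  assumes nonneg: "nonneg_mat A" and sym: "transpose A = A"
  shows "D \<bullet> (A ** D) \<le> max_row_sum A * (norm D)\<^sup>2"
proof -
  define S where "S = (\<Sum>p\<in>UNIV. \<Sum>c\<in>UNIV. \<Sum>q\<in>UNIV. A $ p $ q * (D $ p $ c)\<^sup>2)"
  have A_swap: "A $ p $ q = A $ q $ p" for p q
    by (subst sym[symmetric]) (simp add: transpose_def)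
  have "(\<Sum>p\<in>UNIV. \<Sum>c\<in>UNIV. \<Sum>q\<in>UNIV. A $ p $ q * (D $ q $ c)\<^sup>2) =
        (\<Sum>c\<in>UNIV. \<Sum>p\<in>UNIV. \<Sum>q\<in>UNIV. A $ p $ q * (D $ q $ c)\<^sup>2)"
    by (rule sum.swap)
  also have "\<dots> = (\<Sum>c\<in>UNIV. \<Sum>q\<in>UNIV. \<Sum>p\<in>UNIV. A $ p $ q * (D $ q $ c)\<^sup>2)"
    by (intro sum.cong refl sum.swap)
  also have "\<dots> = (\<Sum>q\<in>UNIV. \<Sum>c\<in>UNIV. \<Sum>p\<in>UNIV. A $ p $ q * (D $ q $ c)\<^sup>2)"
    by (rule sum.swap)
  also have "\<dots> = S"
    unfolding S_def by (intro sum.cong refl) (simp add: A_swap)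
  finally have S_swap: "(\<Sum>p\<in>UNIV. \<Sum>c\<in>UNIV. \<Sum>q\<in>UNIV. A $ p $ q * (D $ q $ c)\<^sup>2) = S" .
  have "D \<bullet> (A ** D) = (\<Sum>p\<in>UNIV. \<Sum>c\<in>UNIV. \<Sum>q\<in>UNIV. A $ p $ q * (D $ p $ c * D $ q $ c))"
    by (simp add: inner_matrix_eq_sum matrix_matrix_mult_def sum_distrib_left mult_ac)
  also have "\<dots> \<le> (\<Sum>p\<in>UNIV. \<Sum>c\<in>UNIV. \<Sum>q\<in>UNIV.
      A $ p $ q * (((D $ p $ c)\<^sup>2 + (D $ q $ c)\<^sup>2) / 2))"
  proof (intro sum_mono mult_left_mono)
    fix p q c
    show "D $ p $ c * D $ q $ c \<le> ((D $ p $ c)\<^sup>2 + (D $ q $ c)\<^sup>2) / 2"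
      using sum_squares_bound[of "D $ p $ c" "D $ q $ c"] by simp
    show "0 \<le> A $ p $ q"
      using nonneg by (simp add: nonneg_mat_def)
  qed
  also have "\<dots> = (S + (\<Sum>p\<in>UNIV. \<Sum>c\<in>UNIV. \<Sum>q\<in>UNIV. A $ p $ q * (D $ q $ c)\<^sup>2)) / 2"
    by (simp add: S_def add_divide_distrib distrib_left sum.distrib sum_divide_distrib)
  also have "\<dots> = S"
    by (simp add: S_swap)
  also have "\<dots> \<le> (\<Sum>p\<in>UNIV. \<Sum>c\<in>UNIV. max_row_sum A * (D $ p $ c)\<^sup>2)"
    unfolding S_def sum_distrib_right[symmetric]
    by (intro sum_mono mult_right_mono row_sum_le_max_row_sum) simp
  also have "\<dots> = max_row_sum A * (norm D)\<^sup>2"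
    by (simp add: norm_matrix_eq_Frobenius sum_nonneg sum_distrib_left)
  finally show ?thesis .
qed

lemma inom_mu_nonneg: "nonneg_mat W \<Longrightarrow> 0 \<le> inom_mu W"
  unfolding inom_mu_def
  by (rule max_row_sum_nonneg)
    (use nonneg_mat_mult[of "transpose W" W] in \<open>auto simp: nonneg_mat_def transpose_def\<close>)

text \<open>\<open>2 *\<^sub>R (transpose W ** W)\<close> is the Hessian of the cost in each column
  of \<open>H\<close>; this bounds the quadratic term of the cost.\<close>

lemma norm_mult_le_inom_mu:
  fixes W :: "real^'r^'n" and D :: "real^'m^'r"
  assumes "nonneg_mat W"
  shows "2 * (norm (W ** D))\<^sup>2 \<le> inom_mu W * (norm D)\<^sup>2"
proof -
  let ?A = "2 *\<^sub>R (transpose W ** W)"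
  have "nonneg_mat (transpose W ** W)"
    using assms by (simp add: nonneg_mat_mult)
  then have nonneg: "nonneg_mat ?A"
    by (simp add: nonneg_mat_def)
  have sym: "transpose ?A = ?A"
    by (simp add: transpose_scalar matrix_transpose_mul)
  have "2 * (norm (W ** D))\<^sup>2 = 2 * (D \<bullet> (transpose W ** (W ** D)))"
    by (simp add: power2_norm_eq_inner inner_matrix_mult_left)
  also have "\<dots> = D \<bullet> (?A ** D)"
    by (simp add: matrix_mul_assoc flip: scalar_matrix_assoc)
  also have "\<dots> \<le> inom_mu W * (norm D)\<^sup>2"
    unfolding inom_mu_def by (rule inner_sym_nonneg_le_max_row_sum[OF nonneg sym])
  finally show ?thesis .
qed

text \<open>Up to a constant, the majorizer is \<open>inom_mu W / 2\<close> times the squared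
  distance to \<open>Z\<close>. Hence mere closeness of \<open>K\<close> suffices, and one lemma
  serves every constraint set.\<close>

lemma nmf_cost_le_if_closer_to_gradient_step:
  fixes V :: "real^'m^'n" and W :: "real^'r^'n" and H K :: "real^'m^'r"
  assumes nonneg: "nonneg_mat W"
    and closer: "norm (K - Z) \<le> norm (H - Z)"
    and Z: "Z = H + (1 / inom_mu W) *\<^sub>R
       (2 *\<^sub>R (transpose W ** V) - 2 *\<^sub>R (transpose W ** W ** H))"
  shows "nmf_cost V W K \<le> nmf_cost V W H"
proof -
  define D where "D = K - H"
  \<comment> \<open>\<open>G\<close> is the negative gradient of the cost at
    \<open>H\<close>.\<close>
  define G where "G = 2 *\<^sub>R (transpose W ** V) - 2 *\<^sub>R (transpose W ** W ** H)"
  have residual: "V - W ** K = (V - W ** H) - W ** D"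
    by (simp add: D_def matrix_mult_diff_right)
  note bound = norm_mult_le_inom_mu[OF nonneg, of D]
  show ?thesis
  proof (cases "inom_mu W = 0")
    case True
    then have "W ** D = 0"
      using bound by simp
    then show ?thesis
      by (simp add: nmf_cost_def residual)
  next
    case False
    define \<mu> where "\<mu> = inom_mu W"
    have \<mu>: "\<mu> > 0"
      using False inom_mu_nonneg[OF nonneg] by (simp add: \<mu>_def)
    have "(norm (K - Z))\<^sup>2 \<le> (norm (H - Z))\<^sup>2"
      using closer by (simp add: power_mono)
    moreover have "K - Z = D - (1 / \<mu>) *\<^sub>R G" and "H - Z = 0 - (1 / \<mu>) *\<^sub>R G"
      by (simp_all add: Z D_def G_def \<mu>_def)
    ultimately have "(norm D)\<^sup>2 - 2 * (D \<bullet> G) / \<mu> \<le> 0"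
      by (simp only: power2_norm_eq_inner) (simp add: inner_diff_left inner_diff_right inner_commute)
    then have step: "\<mu> * (norm D)\<^sup>2 \<le> 2 * (D \<bullet> G)"
      using \<mu> by (simp add: field_simps)
    have "2 * (D \<bullet> (transpose W ** (V - W ** H))) = D \<bullet> G"
      by (simp add: G_def matrix_mult_diff_right inner_diff_right matrix_mul_assoc)
    then have "2 * ((W ** D) \<bullet> (V - W ** H)) = D \<bullet> G"
      by (simp only: inner_matrix_mult_left)
    moreover have expand: "(norm (R - E))\<^sup>2 = (norm R)\<^sup>2 - 2 * (E \<bullet> R) + (norm E)\<^sup>2"
      for R E :: "real^'m^'n"
      by (simp only: power2_norm_eq_inner) (simp add: inner_diff_left inner_diff_right inner_commute)
    ultimately have "nmf_cost V W K = nmf_cost V W H - D \<bullet> G + (norm (W ** D))\<^sup>2"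
      by (simp only: nmf_cost_def residual expand)
    then show ?thesis
      using bound step by (simp add: \<mu>_def)
  qed
qed

lemma nmf_cost_transpose:
  "nmf_cost (transpose V) (transpose H) (transpose W) = nmf_cost V W H"
  by (simp add: nmf_cost_def norm_transpose flip: matrix_transpose_mul transpose_diff)

lemma inom_mu_transpose: "inom_mu (transpose H) = inom_nu H"
  by (simp add: inom_mu_def inom_nu_def)

text \<open>Transposing the factorization exchanges the two factors and turns \<open>inom_nu\<close>
  into \<open>inom_mu\<close>.\<close>

lemma nmf_cost_le_if_closer_to_gradient_step_left:
  fixes V :: "real^'m^'n" and W U :: "real^'r^'n" and H :: "real^'m^'r"
  assumes nonneg: "nonneg_mat H"
    and closer: "norm (U - Z) \<le> norm (W - Z)"
    and Z: "Z = W + (1 / inom_nu H) *\<^sub>R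
       (2 *\<^sub>R (V ** transpose H) - 2 *\<^sub>R (W ** H ** transpose H))"
  shows "nmf_cost V U H \<le> nmf_cost V W H"
proof -
  have "nmf_cost (transpose V) (transpose H) (transpose U)
      \<le> nmf_cost (transpose V) (transpose H) (transpose W)"
  proof (rule nmf_cost_le_if_closer_to_gradient_step)
    show "nonneg_mat (transpose H)"
      using nonneg by simp
    show "norm (transpose U - transpose Z) \<le> norm (transpose W - transpose Z)"
      using closer by (simp add: norm_transpose flip: transpose_diff)
    show "transpose Z = transpose W + (1 / inom_mu (transpose H)) *\<^sub>R
        (2 *\<^sub>R (transpose (transpose H) ** transpose V)
         - 2 *\<^sub>R (transpose (transpose H) ** transpose H ** transpose W))"
      by (simp add: Z inom_mu_transpose transpose_add transpose_diff transpose_scalar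
          matrix_transpose_mul matrix_mul_assoc)
  qed
  then show ?thesis
    by (simp add: nmf_cost_transpose)
qed

section \<open>Nearest points to the gradient step\<close>

lemma norm_pos_part_diff_le:
  fixes Y Z :: "real^'m^'n"
  assumes "nonneg_mat Y"
  shows "norm (pos_part Z - Z) \<le> norm (Y - Z)"
  unfolding norm_matrix_eq_Frobenius
proof (intro real_sqrt_le_mono sum_mono)
  fix i j
  have "0 \<le> Y $ i $ j"
    using assms by (simp add: nonneg_mat_def)
  then have "\<bar>(pos_part Z - Z) $ i $ j\<bar> \<le> \<bar>(Y - Z) $ i $ j\<bar>"
    by (auto simp: pos_part_def max_def)
  then show "((pos_part Z - Z) $ i $ j)\<^sup>2 \<le> ((Y - Z) $ i $ j)\<^sup>2"
    by (rule abs_le_square_iff[THEN iffD1])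
qed

lemma column_diff: "column j (A - B) = column j A - column j (B :: real^'m^'n)"
  by (simp add: column_def vec_eq_iff)

text \<open>Unit columns form a nonconvex set, but among unit vectors the nearest to
  \<open>z\<close> is the one with the largest inner product. For nonnegative \<open>y\<close> this
  is at most \<open>y \<bullet> p\<close>, hence at most \<open>norm p\<close>, which
  \<open>u\<close> attains.\<close>

lemma norm_normalize_pos_part_diff_le:
  fixes Y Z :: "real^'m^'n"
  assumes nonneg: "nonneg_mat Y" and unit: "columns_normalized Y"
    and nonzero: "\<And>j. column j (pos_part Z) \<noteq> 0"
  shows "norm (normalize_columns (pos_part Z) - Z) \<le> norm (Y - Z)"
proof -
  have "(norm (column j (normalize_columns (pos_part Z) - Z)))\<^sup>2 \<le> (norm (column j (Y - Z)))\<^sup>2"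
    for j
  proof -
    define z p y where "z = column j Z" and "p = column j (pos_part Z)" and "y = column j Y"
    define u where "u = (1 / norm p) *\<^sub>R p"
    have p: "norm p > 0"
      using nonzero by (simp add: p_def)
    \<comment> \<open>\<open>p\<close> and \<open>z\<close> agree wherever \<open>p\<close> is
      nonzero.\<close>
    have "p \<bullet> z = p \<bullet> p"
      by (auto simp: p_def z_def pos_part_def column_def inner_vec_def max_def intro!: sum.cong)
    then have uz: "u \<bullet> z = norm p"
      using p by (simp add: u_def power2_eq_square flip: power2_norm_eq_inner)
    have u: "norm u = 1"
      using p by (simp add: u_def)
    have y: "norm y = 1"
      using unit by (simp add: y_def columns_normalized_def)
    have "y \<bullet> z \<le> y \<bullet> p"
      using nonneg
      by (auto simp: y_def z_def p_def pos_part_def column_def inner_vec_def nonneg_mat_def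
          intro!: sum_mono mult_left_mono)
    also have "\<dots> \<le> norm p"
      using norm_cauchy_schwarz[of y p] y by simp
    finally have "y \<bullet> z \<le> u \<bullet> z"
      by (simp add: uz)
    moreover have "u \<bullet> u = y \<bullet> y"
      using u y by (simp flip: power2_norm_eq_inner)
    ultimately have "(norm (u - z))\<^sup>2 \<le> (norm (y - z))\<^sup>2"
      by (simp add: power2_norm_eq_inner inner_diff_left inner_diff_right inner_commute)
    then show ?thesis
      by (simp add: column_diff column_normalize_columns u_def p_def z_def y_def)
  qed
  then have "(norm (normalize_columns (pos_part Z) - Z))\<^sup>2 \<le> (norm (Y - Z))\<^sup>2"
    unfolding norm_matrix_power2_columns by (intro sum_mono)
  then show ?thesis
    by (rule power2_le_imp_le) simp
qed

text \<open>Ensures that normalization never divides by zero, so that unit columns persist.\<close>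

lemma inom_W_update_column_nonzero:
  fixes V :: "real^'m^'n" and W :: "real^'r^'n" and H :: "real^'m^'r"
  assumes V: "nonneg_mat V" "columns_normalized V"
    and W: "nonneg_mat W" "columns_normalized W"
    and H: "nonneg_mat H"
  shows "column j (inom_W_update V W H) \<noteq> 0"
proof
  assume zero: "column j (inom_W_update V W H) = 0"
  \<comment> \<open>The factor 2 of the gradient cancels against \<open>inom_nu H\<close>, leaving
    step length \<open>1 / s\<close>.\<close>
  define s where "s = inom_nu H / 2"
  define G where "G = H ** transpose H"
  define w where "w = column j W"
  define y where "y = column j (V ** transpose H)"
  define x where "x = (\<Sum>i\<in>UNIV. G $ i $ j *\<^sub>R column i W)"
  have w_nonneg: "0 \<le> w $ a" for a
    using W by (simp add: w_def column_def nonneg_mat_def)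
  have norm_w: "norm w = 1"
    using W by (simp add: w_def columns_normalized_def)
  have y_nonneg: "0 \<le> y $ a" for a
  proof -
    have "nonneg_mat (V ** transpose H)"
      using V H by (simp add: nonneg_mat_mult)
    then show ?thesis
      by (simp add: y_def column_def nonneg_mat_def)
  qed
  have G_nonneg: "0 \<le> G $ i $ j" for i j
  proof -
    have "nonneg_mat G"
      using H by (simp add: G_def nonneg_mat_mult)
    then show ?thesis
      by (simp add: nonneg_mat_def)
  qed
  have G_sym: "G $ i $ j = G $ j $ i" for i j
    by (simp add: G_def matrix_matrix_mult_def transpose_def mult.commute)
  have G_sum: "(\<Sum>i\<in>UNIV. G $ i $ j) \<le> s"
    using row_sum_le_max_row_sum[of "2 *\<^sub>R (H ** transpose H)" j]
    by (simp add: s_def inom_nu_def G_def[symmetric] G_sym[of _ j] flip: sum_distrib_left)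
  have entry: "w $ a + (1 / s) * (y $ a - x $ a) \<le> 0" for a
  proof -
    have "(W ** H ** transpose H) $ a $ j = (W ** G) $ a $ j"
      by (simp add: G_def matrix_mul_assoc)
    then have "(W ** H ** transpose H) $ a $ j = x $ a"
      by (simp add: x_def column_def matrix_matrix_mult_def[of W G] mult.commute)
    moreover have "inom_W_update V W H $ a $ j = 0"
      using zero by (simp add: column_def vec_eq_iff)
    ultimately show ?thesis
      by (simp add: inom_W_update_def pos_part_def s_def w_def y_def column_def max_def
          algebra_simps split: if_splits)
  qed
  have "w \<noteq> 0"
    using norm_w by auto
  then obtain a where "w $ a \<noteq> 0"
    by (auto simp: vec_eq_iff)
  then have wa: "w $ a > 0"
    using w_nonneg[of a] by simp
  have "0 \<le> s"
    using G_sum G_nonneg by (meson order_trans sum_nonneg)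
  \<comment> \<open>For \<open>s = 0\<close> the convention \<open>1 / 0 = 0\<close> reduces
    \<open>entry\<close> to \<open>w $ a \<le> 0\<close>.\<close>
  moreover have "s \<noteq> 0"
    using entry[of a] wa by auto
  ultimately have s: "s > 0"
    by simp
  have le: "s * w $ b + y $ b \<le> x $ b" for b
    using entry[of b] s by (simp add: field_simps)
  have "norm (s *\<^sub>R w + y) \<le> norm x"
    by (rule norm_le_componentwise_cart)
      (use le s w_nonneg y_nonneg in \<open>auto intro: order_trans[OF _ abs_ge_self]\<close>)
  \<comment> \<open>\<open>x\<close> combines unit columns with nonnegative weights.\<close>
  also have "norm x \<le> (\<Sum>i\<in>UNIV. G $ i $ j)"
    unfolding x_def
    by (rule sum_norm_le) (use W G_nonneg in \<open>simp add: columns_normalized_def\<close>)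
  also note G_sum
  finally have "(norm (s *\<^sub>R w + y))\<^sup>2 \<le> s\<^sup>2"
    by (simp add: power_mono)
  moreover have "(norm (s *\<^sub>R w + y))\<^sup>2 = s\<^sup>2 + 2 * s * (w \<bullet> y) + (norm y)\<^sup>2"
  proof -
    have "w \<bullet> w = 1"
      using norm_w by (simp add: norm_eq_1)
    then show ?thesis
      by (simp only: power2_norm_eq_inner)
        (simp add: inner_add_left inner_add_right inner_commute power2_eq_square)
  qed
  moreover have "0 \<le> w \<bullet> y"
    by (simp add: inner_vec_def sum_nonneg w_nonneg y_nonneg)
  ultimately have "(norm y)\<^sup>2 \<le> 0"
    using s by (smt (verit) mult_nonneg_nonneg)
  then have "y = 0"
    by simp
  \<comment> \<open>\<open>y = 0\<close> consists of vanishing sums of nonnegative terms, and each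
    column of \<open>V\<close> has a nonzero entry.\<close>
  have "H $ j $ c = 0" for c
  proof -
    have "column c V \<noteq> 0"
      using V by (auto simp: columns_normalized_def dest: spec[of _ c])
    then obtain b where b: "V $ b $ c \<noteq> 0"
      by (auto simp: vec_eq_iff column_def)
    have "(\<Sum>c\<in>UNIV. V $ b $ c * H $ j $ c) = 0"
      using \<open>y = 0\<close>
      by (simp add: y_def column_def vec_eq_iff matrix_matrix_mult_def transpose_def)
    then have "V $ b $ c * H $ j $ c = 0"
      using V H by (subst (asm) sum_nonneg_eq_0_iff) (auto simp: nonneg_mat_def)
    then show ?thesis
      using b by simp
  qed
  then have "G $ i $ j = 0" for i
    by (simp add: G_def matrix_matrix_mult_def transpose_def)
  then have "x = 0"
    by (simp add: x_def)
  \<comment> \<open>Now \<open>le\<close> reads \<open>s * w $ a \<le> 0\<close>, with both factors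
    positive.\<close>
  then show False
    using le[of a] s wa \<open>y = 0\<close> by (simp add: mult_le_0_iff)
qed

section \<open>Descent of the updates and of the algorithm\<close>

lemma inom_H_update_descent:
  assumes "nonneg_mat W" "nonneg_mat H"
  shows "nmf_cost V W (inom_H_update V W H) \<le> nmf_cost V W H"
  unfolding inom_H_update_def
  by (rule nmf_cost_le_if_closer_to_gradient_step[OF assms(1) _ refl])
    (rule norm_pos_part_diff_le[OF assms(2)])

lemma inom_W_update_descent:
  assumes "nonneg_mat W" "nonneg_mat H"
  shows "nmf_cost V (inom_W_update V W H) H \<le> nmf_cost V W H"
  unfolding inom_W_update_def
  by (rule nmf_cost_le_if_closer_to_gradient_step_left[OF assms(2) _ refl])
    (rule norm_pos_part_diff_le[OF assms(1)])

text \<open>\<open>W\<close> itself has unit columns, so it competes with the normalized step for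
  closeness to the gradient step.\<close>

lemma normalized_inom_W_update_descent:
  assumes V: "nonneg_mat V" "columns_normalized V"
    and W: "nonneg_mat W" "columns_normalized W"
    and H: "nonneg_mat H"
  shows "nmf_cost V (normalize_columns (inom_W_update V W H)) H \<le> nmf_cost V W H"
  using inom_W_update_column_nonzero[OF assms] unfolding inom_W_update_def
  by (intro nmf_cost_le_if_closer_to_gradient_step_left[OF H _ refl]
      norm_normalize_pos_part_diff_le[OF W])

text \<open>The last two conjuncts compare the \<open>W\<close> step before and after normalization
  directly with \<open>W k\<close>; neither is derived from the other.\<close>

theorem mainTheorem2:
  fixes V :: "real^'m^'n"
    and W :: "nat \<Rightarrow> real^'r^'n"
    and H :: "nat \<Rightarrow> real^'m^'r"
  assumes "CARD('r) < CARD('n)"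
    and "CARD('r) < CARD('m)"
    and "nonneg_mat V"
    and "columns_normalized V"
    and "nonneg_mat (W 0)"
    and "columns_normalized (W 0)"
    and "nonneg_mat (H 0)"
    and "inom_sequence V W H"
  shows "\<forall>k. nmf_cost V (W k) (H (Suc k)) \<le> nmf_cost V (W k) (H k)
           \<and> nmf_cost V (inom_W_update V (W k) (H (Suc k))) (H (Suc k))
               \<le> nmf_cost V (W k) (H (Suc k))
           \<and> nmf_cost V (W (Suc k)) (H (Suc k)) \<le> nmf_cost V (W k) (H (Suc k))"
proof -
  have H_step: "H (Suc k) = inom_H_update V (W k) (H k)"
    and W_step: "W (Suc k) = normalize_columns (inom_W_update V (W k) (H (Suc k)))" for k
    using assms(8) by (simp_all add: inom_sequence_def)
  have H_nonneg: "nonneg_mat (H k)" for k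
    using assms(7) by (cases k) (simp_all add: H_step inom_H_update_def)
  \<comment> \<open>Unit columns belong to the invariant because the nonvanishing of the next
    columns relies on them.\<close>
  have W_inv: "nonneg_mat (W k) \<and> columns_normalized (W k)" for k
  proof (induction k)
    case 0
    then show ?case
      using assms(5,6) by simp
  next
    case (Suc k)
    have "nonneg_mat (W (Suc k))"
      unfolding W_step by (rule nonneg_mat_normalize_columns) (simp add: inom_W_update_def)
    moreover have "columns_normalized (W (Suc k))"
      using inom_W_update_column_nonzero[OF assms(3,4), of "W k" "H (Suc k)"] Suc H_nonneg
      by (simp add: columns_normalized_def W_step column_normalize_columns)
    ultimately show ?case
      by simp
  qed
  show ?thesis
    using W_inv H_nonneg assms(3,4)
    by (metis H_step W_step inom_H_update_descent inom_W_update_descent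
        normalized_inom_W_update_descent)
qed

end
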